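(* Fix $\beta>0$ and $n\geq 1$. Let $\mathcal{H}(\mathcal{C})$ be the chained model built from trial models $\mathcal{C}_{i|\mathbf{c}_{<i}\mathbf{z}_{<i}e}$, $i=1,\dots,n$. For each $i$ let $F_i=F_i(C_iZ_i;\mathbf{C}_{<i}\mathbf{Z}_{<i})$ be a past-parameterized probability estimation factor (PEF) with power $\beta$ for the $i$'th trial, and let $T_n=\prod_{i=1}^n F_i$. Then for each value $e$ of $E$, each $\mu_e\in\mathcal{H}(\mathcal{C})$ (a distribution of $\mathbf{C}\mathbf{Z}$ satisfying the chained-model conditions for that $e$), and each $\epsilon>0$, $$\mathbb{P}_{\mu_e}\Big(\mu_e(\mathbf{C}|\mathbf{Z})\ \geq\ (\epsilon T_n)^{-1/\beta}\Big)\ \leq\ \epsilon .$$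
   Context: All random variables (RVs) have countable value spaces. Conditional probabilities whose conditioner has probability zero are set to $0$, and zero-probability values are ignored. $\mathbf{Z}=(Z_i)_{i=1}^n$ (inputs) and $\mathbf{C}=(C_i)_{i=1}^n$ (outputs) are sequences of RVs, $\mathbf{C}_{<i}=(C_j)_{j=1}^{i-1}$, similarly $\mathbf{Z}_{<i}$, and $E$ is an RV (side information). $\mu_e(\mathbf{C}|\mathbf{Z})$ denotes the RV that takes the value $\mu_e(\mathbf{C}=\mathbf{c}|\mathbf{Z}=\mathbf{z})$ when $\mathbf{C}=\mathbf{c}$, $\mathbf{Z}=\mathbf{z}$. By convention $0^{-1/\beta}=+\infty$. For each trial $i$, each past $\mathbf{c}_{<i}\mathbf{z}_{<i}$ and each $e$, the trial model $\mathcal{C}_{i|\mathbf{c}_{<i}\mathbf{z}_{<i}e}$ is a set of distributions of $C_iZ_i$. The chained model $\mathcal{H}(\mathcal{C})$ consists of all distributions $\mu_e$ of $\mathbf{C}\mathbf{Z}$ (thought of as conditional on $E=e$) such that (1) for all $i$ and $\mathbf{c}_{<i},\mathbf{z}_{<i}$, the conditional distribution $\mu_e(C_iZ_i|\mathbf{c}_{<i}\mathbf{z}_{<i})$ is in $\mathcal{C}_{i|\mathbf{c}_{<i}\mathbf{z}_{<i}e}$; and (2) for all $i$, under $\mu_e$, $Z_i$ is independent of $\mathbf{C}_{<i}$ conditionally on $\mathbf{Z}_{<i}$. For $\beta>0$ and a set $\mathcal{C}$ of distributions of $CZ$, a PEF with power $\beta$ for $\mathcal{C}$ is a function $F:cz\mapsto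 F(cz)\ge 0$ with $\mathbb{E}_\sigma\big(F(CZ)\,\sigma(C|Z)^\beta\big)=\sum_{cz}F(cz)\sigma(c|z)^\beta\sigma(cz)\le 1$ for all $\sigma\in\mathcal{C}$. "Past-parameterized PEF for the $i$'th trial" means that for every past $\mathbf{c}_{<i}\mathbf{z}_{<i}$, the function $F_i(\,\cdot\,;\mathbf{c}_{<i}\mathbf{z}_{<i})$ is a PEF with power $\beta$ for $\mathcal{C}_{i|\mathbf{c}_{<i}\mathbf{z}_{<i}e}$ for every $e$ (and $F_i$ does not depend on $e$). *)

theory Defs
  imports "HOL-Probability.Probability"
begin

text \<open>
  Trials are numbered \<open>0, \<dots>, n - 1\<close>.  A sequence of \<open>n\<close> outputs (inputs) is a list of length
  \<open>n\<close>, and the past of trial \<open>i\<close> consists of the prefixes of length \<open>i\<close>.  All outputs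
  share one countable type, and so do all inputs; trial-dependent value spaces are subsets of it.
\<close>

text \<open>
  \<open>\<sigma>(c|z)\<close>, used both for one trial and for whole sequences.  The library's conditional
  probability is a quotient, hence \<open>0\<close> when the conditioner has probability zero.
\<close>

definition cprob :: "('a \<times> 'b) pmf \<Rightarrow> 'a \<Rightarrow> 'b \<Rightarrow> real" where
  "cprob \<sigma> c z = \<P>(x in measure_pmf \<sigma>. fst x = c \<bar> snd x = z)"

text \<open>
  The expectation is a nonnegative extended-real integral, so that a divergent sum counts as
  \<open>\<infinity>\<close> and not as \<open>0\<close>.
\<close>

definition PEF :: "real \<Rightarrow> ('c \<times> 'z) pmf set \<Rightarrow> ('c \<times> 'z \<Rightarrow> real) \<Rightarrow> bool" where
  "PEF \<beta> M F \<longleftrightarrow>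
     (\<forall>cz. F cz \<ge> 0) \<and>
     (\<forall>\<sigma>\<in>M. (\<integral>\<^sup>+ cz. ennreal (F cz * cprob \<sigma> (fst cz) (snd cz) powr \<beta>) \<partial>measure_pmf \<sigma>) \<le> 1)"

text \<open>
  \<open>M i cs zs e\<close> is the model of trial \<open>i\<close> given past outputs \<open>cs\<close>, past inputs \<open>zs\<close> and side
  information \<open>e\<close>.
\<close>

type_synonym ('c, 'z, 'e) trial_models =
  "nat \<Rightarrow> 'c list \<Rightarrow> 'z list \<Rightarrow> 'e \<Rightarrow> ('c \<times> 'z) pmf set"

definition past_param_PEF ::
  "real \<Rightarrow> ('c, 'z, 'e) trial_models \<Rightarrow> nat \<Rightarrow> ('c list \<Rightarrow> 'z list \<Rightarrow> 'c \<times> 'z \<Rightarrow> real) \<Rightarrow> bool"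
where
  "past_param_PEF \<beta> M i F \<longleftrightarrow>
     (\<forall>cs zs e. length cs = i \<longrightarrow> length zs = i \<longrightarrow> PEF \<beta> (M i cs zs e) (F cs zs))"

definition past_event :: "nat \<Rightarrow> 'c list \<Rightarrow> 'z list \<Rightarrow> ('c list \<times> 'z list) set" where
  "past_event i cs zs = {x. take i (fst x) = cs \<and> take i (snd x) = zs}"

definition trial_dist ::
  "('c list \<times> 'z list) pmf \<Rightarrow> nat \<Rightarrow> 'c list \<Rightarrow> 'z list \<Rightarrow> ('c \<times> 'z) pmf" where
  "trial_dist \<mu> i cs zs = map_pmf (\<lambda>x. (fst x ! i, snd x ! i)) (cond_pmf \<mu> (past_event i cs zs))"

text \<open>
  In the second clause, pasts of probability zero are excluded: \<open>cond_pmf\<close> is unspecified there.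
  The third clause needs no such guard, as it reads \<open>0 = 0 * 0\<close> when the conditioner has
  probability zero.
\<close>

definition chained_model ::
  "nat \<Rightarrow> ('c, 'z, 'e) trial_models \<Rightarrow> 'e \<Rightarrow> ('c list \<times> 'z list) pmf set" where
  "chained_model n M e = {\<mu>.
     set_pmf \<mu> \<subseteq> {c. length c = n} \<times> {z. length z = n} \<and>
     (\<forall>i<n. \<forall>cs zs. measure_pmf.prob \<mu> (past_event i cs zs) > 0 \<longrightarrow>
        trial_dist \<mu> i cs zs \<in> M i cs zs e) \<and>
     (\<forall>i<n. \<forall>cs zs z.
        \<P>(x in measure_pmf \<mu>. snd x ! i = z \<and> take i (fst x) = cs \<bar> take i (snd x) = zs) =
        \<P>(x in measure_pmf \<mu>. snd x ! i = z \<bar> take i (snd x) = zs) *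
        \<P>(x in measure_pmf \<mu>. take i (fst x) = cs \<bar> take i (snd x) = zs))}"

definition PEF_prod ::
  "nat \<Rightarrow> (nat \<Rightarrow> 'c list \<Rightarrow> 'z list \<Rightarrow> 'c \<times> 'z \<Rightarrow> real) \<Rightarrow> 'c list \<Rightarrow> 'z list \<Rightarrow> real" where
  "PEF_prod n F c z = (\<Prod>i<n. F i (take i c) (take i z) (c ! i, z ! i))"

text \<open>
  The power \<open>x powr (- 1 / \<beta>)\<close> for \<open>x \<ge> 0\<close> with value \<open>\<infinity>\<close> at \<open>0\<close>; the library has \<open>0 powr a = 0\<close>.
\<close>

definition neg_root :: "real \<Rightarrow> real \<Rightarrow> ereal" where
  "neg_root \<beta> x = (if x = 0 then \<infinity> else ereal (x powr (- 1 / \<beta>)))"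

end

theory Submission
  imports Defs
begin

text \<open>
  By the chain rule and the conditional independence of inputs from past outputs,
  \<open>\<mu>(C|Z)\<close> is the product of the trial-wise conditional probabilities given the past.
  Hence \<open>T\<^sub>n \<mu>(C|Z)\<^sup>\<beta>\<close> is a product of factors whose conditional expectations given
  the past are at most \<open>1\<close>; by the tower property its expectation is at most \<open>1\<close>, and
  Markov's inequality applies.
\<close>

section \<open>Conditioning and the tower property for pmfs\<close>

lemma measure_cond_pmf:
  assumes "set_pmf p \<inter> s \<noteq> {}"
  shows "measure_pmf.prob (cond_pmf p s) A = measure_pmf.prob p (s \<inter> A) / measure_pmf.prob p s"
  using emeasure_measure_pmf_not_zero[OF assms]
  by (simp add: cond_pmf.rep_eq[OF assms])

text \<open>A fibre of \<open>h\<close> has the same mass under \<open>p\<close> as its value has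
  under \<open>map_pmf h p\<close>, so this weight cancels the normalisation in
  \<open>cond_pmf\<close>.\<close>

lemma bind_cond_pmf_fibres: "bind_pmf (map_pmf h p) (\<lambda>y. cond_pmf p {x. y = h x}) = p"
  by (rule bind_cond_pmf_cancel) (auto simp: vimage_def eq_commute)

text \<open>The factor \<open>g (h x)\<close> is constant on each fibre of \<open>h\<close> and can
  be pulled out of the conditional expectation, which leaves at most \<open>1\<close>. This is the
  one-step supermartingale bound, with \<open>h\<close> as the past.\<close>

lemma nn_integral_pmf_fibres_le:
  assumes f: "\<And>y. y \<in> h ` set_pmf p \<Longrightarrow> (\<integral>\<^sup>+x. f x \<partial>cond_pmf p {x. y = h x}) \<le> 1"
  shows "(\<integral>\<^sup>+x. g (h x) * f x \<partial>measure_pmf p) \<le> (\<integral>\<^sup>+x. g (h x) \<partial>measure_pmf p)"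
proof -
  have inner: "(\<integral>\<^sup>+x. g (h x) * f x \<partial>cond_pmf p {x. y = h x}) \<le> g y"
    if y: "y \<in> h ` set_pmf p" for y
  proof -
    have *: "set_pmf p \<inter> {x. y = h x} \<noteq> {}"
      using y by auto
    have "(\<integral>\<^sup>+x. g (h x) * f x \<partial>cond_pmf p {x. y = h x})
        = (\<integral>\<^sup>+x. g y * f x \<partial>cond_pmf p {x. y = h x})"
      by (rule nn_integral_cong_AE) (auto simp: AE_measure_pmf_iff set_cond_pmf[OF *])
    also have "\<dots> = g y * (\<integral>\<^sup>+x. f x \<partial>cond_pmf p {x. y = h x})"
      by (rule nn_integral_cmult) simp
    also have "\<dots> \<le> g y * 1"
      by (rule mult_left_mono[OF f[OF y]]) simp
    finally show ?thesis by simp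
  qed
  have "(\<integral>\<^sup>+x. g (h x) * f x \<partial>measure_pmf p)
      = (\<integral>\<^sup>+x. g (h x) * f x \<partial>bind_pmf (map_pmf h p) (\<lambda>y. cond_pmf p {x. y = h x}))"
    by (simp only: bind_cond_pmf_fibres)
  also have "\<dots> = (\<integral>\<^sup>+y. (\<integral>\<^sup>+x. g (h x) * f x \<partial>cond_pmf p {x. y = h x}) \<partial>map_pmf h p)"
    by simp
  also have "\<dots> \<le> (\<integral>\<^sup>+y. g y \<partial>map_pmf h p)"
    by (rule nn_integral_mono_AE) (auto simp: AE_measure_pmf_iff intro: inner)
  also have "\<dots> = (\<integral>\<^sup>+x. g (h x) \<partial>measure_pmf p)"
    by simp
  finally show ?thesis .
qed

section \<open>Chain rule for prefix conditional probabilities\<close>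

text \<open>The quantity tracked by the induction over trials: it starts at \<open>1\<close> for
  empty prefixes and ends at \<open>cprob\<close> for \<open>k = n\<close>.\<close>

definition prefix_cprob ::
  "('c list \<times> 'z list) pmf \<Rightarrow> nat \<Rightarrow> 'c list \<Rightarrow> 'z list \<Rightarrow> real" where
  "prefix_cprob \<mu> k cs zs = \<P>(x in measure_pmf \<mu>. take k (fst x) = cs \<bar> take k (snd x) = zs)"

lemma prefix_cprob_nonneg: "prefix_cprob \<mu> k cs zs \<ge> 0"
  by (simp add: prefix_cprob_def cond_prob_def)

lemma prefix_cprob_0: "prefix_cprob \<mu> 0 [] [] = 1"
  by (simp add: prefix_cprob_def cond_prob_def)

lemma prefix_cprob_full:
  assumes "set_pmf \<mu> \<subseteq> {c. length c = n} \<times> {z. length z = n}"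
  shows "prefix_cprob \<mu> n c z = cprob \<mu> c z"
proof -
  have "measure_pmf.prob \<mu> {x. take n (fst x) = c \<and> take n (snd x) = z}
      = measure_pmf.prob \<mu> {x. fst x = c \<and> snd x = z}"
    "measure_pmf.prob \<mu> {x. take n (snd x) = z} = measure_pmf.prob \<mu> {x. snd x = z}"
    using assms by (intro measure_pmf.finite_measure_eq_AE; fastforce simp: AE_measure_pmf_iff)+
  then show ?thesis
    by (simp add: prefix_cprob_def cprob_def cond_prob_def)
qed

lemma take_Suc_eq_iff:
  assumes "k < length xs" "k < length ys"
  shows "take (Suc k) xs = take (Suc k) ys \<longleftrightarrow> take k xs = take k ys \<and> xs ! k = ys ! k"
  using assms by (auto simp: take_Suc_conv_app_nth)

text \<open>Numerator and denominator both carry the mass of the past as normalisation, and it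
  cancels. The hypothesis makes this mass positive.\<close>

lemma cprob_trial_dist:
  assumes "set_pmf \<mu> \<inter> past_event k cs zs \<noteq> {}"
  shows "cprob (trial_dist \<mu> k cs zs) c z =
    measure_pmf.prob \<mu> {x. take k (fst x) = cs \<and> take k (snd x) = zs \<and> fst x ! k = c \<and> snd x ! k = z}
    / measure_pmf.prob \<mu> {x. take k (fst x) = cs \<and> take k (snd x) = zs \<and> snd x ! k = z}"
proof -
  have *: "past_event k cs zs \<inter> {x. P x} =
      {x. take k (fst x) = cs \<and> take k (snd x) = zs \<and> P x}" for P
    by (auto simp: past_event_def)
  have "measure_pmf.prob \<mu> (past_event k cs zs) \<noteq> 0"
    by (rule measure_measure_pmf_not_zero[OF assms])
  then show ?thesis
    by (simp add: cprob_def cond_prob_def trial_dist_def measure_cond_pmf[OF assms] vimage_def *)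
qed

text \<open>The chain rule gives the new trial's conditional probability times that of the past
  outputs given the inputs up to and including trial \<open>k\<close>. Conditional independence
  removes input \<open>k\<close> from the latter conditioner. Taking \<open>x\<close> in the support
  keeps every conditioner positive.\<close>

lemma prefix_cprob_Suc:
  assumes \<mu>: "\<mu> \<in> chained_model n M e" and k: "k < n" and x: "x \<in> set_pmf \<mu>"
  shows "prefix_cprob \<mu> (Suc k) (take (Suc k) (fst x)) (take (Suc k) (snd x)) =
    prefix_cprob \<mu> k (take k (fst x)) (take k (snd x)) *
    cprob (trial_dist \<mu> k (take k (fst x)) (take k (snd x))) (fst x ! k) (snd x ! k)"
proof -
  obtain c z where xcz: "x = (c, z)" by (cases x)
  define cs zs where "cs = take k c" and "zs = take k z"
  let ?P = "measure_pmf.prob \<mu>"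
  have len: "set_pmf \<mu> \<subseteq> {c. length c = n} \<times> {z. length z = n}"
    using \<mu> by (simp add: chained_model_def)
  have len_k: "k < length (fst y)" "k < length (snd y)" if "y \<in> set_pmf \<mu>" for y
    using len that k by auto
  have ck: "k < length c" and zk: "k < length z"
    using len_k[OF x] by (auto simp: xcz)
  have ne: "set_pmf \<mu> \<inter> past_event k cs zs \<noteq> {}"
    using x by (auto simp: xcz past_event_def cs_def zs_def)
  \<comment> \<open>\<open>A\<close> and \<open>B\<close> belong to the past alone;
    \<open>A1\<close> and \<open>B1\<close> are their extensions by trial \<open>k\<close>. The
    intermediate \<open>Q\<close> adds to the event of \<open>A\<close> only the input of trial
    \<open>k\<close>.\<close>
  define A B A1 B1 Q where
    "A = ?P {y. take k (fst y) = cs \<and> take k (snd y) = zs}" and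
    "B = ?P {y. take k (snd y) = zs}" and
    "A1 = ?P {y. take k (fst y) = cs \<and> take k (snd y) = zs \<and> fst y ! k = c ! k \<and> snd y ! k = z ! k}" and
    "B1 = ?P {y. take k (snd y) = zs \<and> snd y ! k = z ! k}" and
    "Q = ?P {y. take k (fst y) = cs \<and> take k (snd y) = zs \<and> snd y ! k = z ! k}"
  have pos: "A \<noteq> 0" "B \<noteq> 0" "B1 \<noteq> 0" "Q \<noteq> 0"
    unfolding A_def B_def B1_def Q_def using x
    by (auto intro!: measure_measure_pmf_not_zero simp: xcz cs_def zs_def)
  have "?P {y. take (Suc k) (fst y) = take (Suc k) c \<and> take (Suc k) (snd y) = take (Suc k) z} = A1"
    unfolding A1_def cs_def zs_def
    by (rule measure_pmf.finite_measure_eq_AE)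
      (auto simp: AE_measure_pmf_iff take_Suc_eq_iff len_k ck zk)
  moreover have "?P {y. take (Suc k) (snd y) = take (Suc k) z} = B1"
    unfolding B1_def zs_def
    by (rule measure_pmf.finite_measure_eq_AE)
      (auto simp: AE_measure_pmf_iff take_Suc_eq_iff len_k zk)
  ultimately have lhs: "prefix_cprob \<mu> (Suc k) (take (Suc k) c) (take (Suc k) z) = A1 / B1"
    by (simp add: prefix_cprob_def cond_prob_def)
  have W: "prefix_cprob \<mu> k cs zs = A / B"
    by (simp add: prefix_cprob_def cond_prob_def A_def B_def)
  have T: "cprob (trial_dist \<mu> k cs zs) (c ! k) (z ! k) = A1 / Q"
    by (simp add: cprob_trial_dist[OF ne] A1_def Q_def)
  have "\<P>(y in measure_pmf \<mu>. snd y ! k = z ! k \<and> take k (fst y) = cs \<bar> take k (snd y) = zs) =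
        \<P>(y in measure_pmf \<mu>. snd y ! k = z ! k \<bar> take k (snd y) = zs) *
        \<P>(y in measure_pmf \<mu>. take k (fst y) = cs \<bar> take k (snd y) = zs)"
    using \<mu> k by (simp add: chained_model_def)
  then have "Q / B = B1 / B * (A / B)"
    by (simp add: cond_prob_def A_def B_def B1_def Q_def conj_ac)
  \<comment> \<open>The present input does not change the conditional probability of the past
    outputs.\<close>
  then have "Q / B1 = A / B"
    using pos by (simp add: field_simps)
  then have "A1 / B1 = A / B * (A1 / Q)"
    using pos by (simp add: field_simps)
  then show ?thesis
    unfolding xcz fst_conv snd_conv lhs using W T by (simp add: cs_def zs_def)
qed

section \<open>Products of PEFs and their expectation\<close>

lemma PEF_prod_nonneg:
  assumes "\<And>i. i < n \<Longrightarrow> past_param_PEF \<beta> M i (F i)" "length c = n" "length z = n"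
  shows "PEF_prod n F c z \<ge> 0"
  unfolding PEF_prod_def
proof (rule prod_nonneg)
  fix i assume "i \<in> {..<n}"
  \<comment> \<open>Only the nonnegativity clause of \<open>PEF\<close> is wanted, and it does not
    mention the model, so any side information will do.\<close>
  then have "PEF \<beta> (M i (take i c) (take i z) undefined) (F i (take i c) (take i z))"
    using assms by (auto simp: past_param_PEF_def)
  then show "F i (take i c) (take i z) (c ! i, z ! i) \<ge> 0"
    by (simp add: PEF_def)
qed

lemma PEF_prod_Suc:
  "PEF_prod (Suc k) F c z = PEF_prod k F c z * F k (take k c) (take k z) (c ! k, z ! k)"
  by (simp add: PEF_prod_def)

text \<open>The factors with index below \<open>k\<close> look only at positions below
  \<open>k\<close>; hence the partial product is a function of the past.\<close>

lemma PEF_prod_take: "PEF_prod k F (take k c) (take k z) = PEF_prod k F c z"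
  by (simp add: PEF_prod_def)

text \<open>The integrands form a supermartingale starting at \<open>1\<close>: each trial
  contributes a factor whose conditional expectation given the past is at most \<open>1\<close> by
  the PEF property.\<close>

lemma expectation_prefix_PEF_prod_le_1:
  assumes F: "\<And>i. i < n \<Longrightarrow> past_param_PEF \<beta> M i (F i)"
    and \<mu>: "\<mu> \<in> chained_model n M e" and "k \<le> n"
  shows "(\<integral>\<^sup>+x. ennreal (PEF_prod k F (fst x) (snd x) *
      prefix_cprob \<mu> k (take k (fst x)) (take k (snd x)) powr \<beta>) \<partial>measure_pmf \<mu>) \<le> 1"
  using \<open>k \<le> n\<close>
proof (induction k)
  case 0
  show ?case
    by (simp add: PEF_prod_def prefix_cprob_0)
next
  case (Suc k)
  then have k: "k < n" by simp
  have len: "length (fst x) = n" "length (snd x) = n" if "x \<in> set_pmf \<mu>" for x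
    using \<mu> that by (auto simp: chained_model_def)
  \<comment> \<open>\<open>h\<close> extracts the past of trial \<open>k\<close>, \<open>g\<close>
    is the integrand accumulated over that past, and \<open>f'\<close> is the factor contributed by
    trial \<open>k\<close>.\<close>
  define h :: "'a list \<times> 'b list \<Rightarrow> 'a list \<times> 'b list"
    where "h = (\<lambda>x. (take k (fst x), take k (snd x)))"
  define g where
    "g y = ennreal (PEF_prod k F (fst y) (snd y) * prefix_cprob \<mu> k (fst y) (snd y) powr \<beta>)" for y
  define f where
    "f cs zs cz = F k cs zs cz * cprob (trial_dist \<mu> k cs zs) (fst cz) (snd cz) powr \<beta>" for cs zs cz
  define f' where "f' x = ennreal (f (take k (fst x)) (take k (snd x)) (fst x ! k, snd x ! k))" for x
  have gh: "g (h x) = ennreal (PEF_prod k F (fst x) (snd x) *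
      prefix_cprob \<mu> k (take k (fst x)) (take k (snd x)) powr \<beta>)" for x
    by (simp add: g_def h_def PEF_prod_take)
  have split: "ennreal (PEF_prod (Suc k) F (fst x) (snd x) *
      prefix_cprob \<mu> (Suc k) (take (Suc k) (fst x)) (take (Suc k) (snd x)) powr \<beta>) = g (h x) * f' x"
    if x: "x \<in> set_pmf \<mu>" for x
  proof -
    have "PEF_prod k F (take k (fst x)) (take k (snd x)) \<ge> 0"
      using F k len[OF x] by (intro PEF_prod_nonneg[where \<beta>=\<beta> and M=M]) auto
    then show ?thesis
      unfolding gh f'_def f_def PEF_prod_take
      by (subst ennreal_mult'[symmetric])
        (simp_all add: prefix_cprob_Suc[OF \<mu> k x] PEF_prod_Suc powr_mult prefix_cprob_nonneg mult_ac)
  qed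
  have inner: "(\<integral>\<^sup>+x. f' x \<partial>cond_pmf \<mu> {x. y = h x}) \<le> 1" if yh: "y \<in> h ` set_pmf \<mu>" for y
  proof -
    obtain x where x: "x \<in> set_pmf \<mu>" "y = h x"
      using yh by blast
    define cs zs where "cs = take k (fst x)" and "zs = take k (snd x)"
    have y: "y = (cs, zs)" by (simp add: x h_def cs_def zs_def)
    have ev: "{x. y = h x} = past_event k cs zs"
      by (auto simp: y h_def past_event_def)
    have ne: "set_pmf \<mu> \<inter> past_event k cs zs \<noteq> {}"
      using x by (auto simp: ev[symmetric])
    \<comment> \<open>The past comes from a point of the support, so the positivity guard in
      \<open>chained_model\<close> is met.\<close>
    have "measure_pmf.prob \<mu> (past_event k cs zs) > 0"
      using measure_measure_pmf_not_zero[OF ne] by (simp add: zero_less_measure_iff)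
    then have "trial_dist \<mu> k cs zs \<in> M k cs zs e"
      using \<mu> k by (auto simp: chained_model_def)
    moreover have "PEF \<beta> (M k cs zs e) (F k cs zs)"
      using F[OF k] len[OF x(1)] k by (simp add: past_param_PEF_def cs_def zs_def)
    ultimately have "(\<integral>\<^sup>+cz. ennreal (f cs zs cz) \<partial>trial_dist \<mu> k cs zs) \<le> 1"
      by (simp add: PEF_def f_def)
    also have "(\<integral>\<^sup>+cz. ennreal (f cs zs cz) \<partial>trial_dist \<mu> k cs zs)
        = (\<integral>\<^sup>+x. ennreal (f cs zs (fst x ! k, snd x ! k)) \<partial>cond_pmf \<mu> (past_event k cs zs))"
      by (subst trial_dist_def) simp
    also have "\<dots> = (\<integral>\<^sup>+x. f' x \<partial>cond_pmf \<mu> (past_event k cs zs))"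
      by (rule nn_integral_cong_AE)
        (simp add: AE_measure_pmf_iff set_cond_pmf[OF ne] f'_def, simp add: past_event_def)
    finally show ?thesis
      by (simp add: ev)
  qed
  have "(\<integral>\<^sup>+x. ennreal (PEF_prod (Suc k) F (fst x) (snd x) *
      prefix_cprob \<mu> (Suc k) (take (Suc k) (fst x)) (take (Suc k) (snd x)) powr \<beta>) \<partial>measure_pmf \<mu>)
      = (\<integral>\<^sup>+x. g (h x) * f' x \<partial>measure_pmf \<mu>)"
    by (rule nn_integral_cong_AE) (simp add: AE_measure_pmf_iff split)
  also have "\<dots> \<le> (\<integral>\<^sup>+x. g (h x) \<partial>measure_pmf \<mu>)"
    by (rule nn_integral_pmf_fibres_le[OF inner])
  also have "\<dots> \<le> 1"
    unfolding gh using Suc by simp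
  finally show ?case .
qed

section \<open>Markov's inequality\<close>

lemma one_le_if_neg_root_le:
  assumes "\<beta> > 0" "t \<ge> 0" and le: "neg_root \<beta> t \<le> ereal w"
  shows "1 \<le> t * w powr \<beta>"
proof -
  \<comment> \<open>At \<open>t = 0\<close> the threshold is \<infinity>, which the finite
    \<open>w\<close> cannot reach.\<close>
  have t: "t > 0" and tw: "t powr (- 1 / \<beta>) \<le> w"
    using assms by (auto simp: neg_root_def split: if_splits)
  have "(t powr (- 1 / \<beta>)) powr \<beta> = t powr (- 1)"
    using \<open>\<beta> > 0\<close> by (subst powr_powr) simp
  then have "1 = t * (t powr (- 1 / \<beta>)) powr \<beta>"
    using t by (simp add: powr_minus)
  also have "\<dots> \<le> t * w powr \<beta>"
    using t tw \<open>\<beta> > 0\<close> by (intro mult_left_mono powr_mono2) auto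
  finally show ?thesis .
qed

theorem theorem9:
  fixes \<beta> \<epsilon> :: real and n :: nat
    and M :: "('c::countable, 'z::countable, 'e::countable) trial_models"
    and F :: "nat \<Rightarrow> 'c list \<Rightarrow> 'z list \<Rightarrow> 'c \<times> 'z \<Rightarrow> real"
    and e :: 'e and \<mu> :: "('c list \<times> 'z list) pmf"
  assumes "\<beta> > 0" and "n \<ge> 1"
    and "\<And>i. i < n \<Longrightarrow> past_param_PEF \<beta> M i (F i)"
    and "\<mu> \<in> chained_model n M e"
    and "\<epsilon> > 0"
  shows "\<P>(x in measure_pmf \<mu>.
           ereal (cprob \<mu> (fst x) (snd x)) \<ge> neg_root \<beta> (\<epsilon> * PEF_prod n F (fst x) (snd x))) \<le> \<epsilon>"
proof -
  let ?E = "{x. neg_root \<beta> (\<epsilon> * PEF_prod n F (fst x) (snd x)) \<le> ereal (cprob \<mu> (fst x) (snd x))}"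
  define u where "u x = PEF_prod n F (fst x) (snd x) * cprob \<mu> (fst x) (snd x) powr \<beta>" for x
  have len: "set_pmf \<mu> \<subseteq> {c. length c = n} \<times> {z. length z = n}"
    using assms(4) by (simp add: chained_model_def)
  have "(\<integral>\<^sup>+x. ennreal (u x) \<partial>measure_pmf \<mu>) =
      (\<integral>\<^sup>+x. ennreal (PEF_prod n F (fst x) (snd x) *
        prefix_cprob \<mu> n (take n (fst x)) (take n (snd x)) powr \<beta>) \<partial>measure_pmf \<mu>)"
    using len by (intro nn_integral_cong_AE)
      (auto simp: AE_measure_pmf_iff u_def prefix_cprob_full[OF len])
  also have "\<dots> \<le> 1"
    by (rule expectation_prefix_PEF_prod_le_1[OF assms(3,4) order_refl])
  finally have u_le: "(\<integral>\<^sup>+x. ennreal (u x) \<partial>measure_pmf \<mu>) \<le> 1" .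
  \<comment> \<open>The pointwise form of Markov's inequality: on \<open>?E\<close> the threshold
    condition says that \<epsilon> times \<open>u x\<close> is at least \<open>1\<close>.
    Restricting to the support gives lists of length \<open>n\<close>, for which the PEF product is
    known to be nonnegative.\<close>
  have ind: "indicator ?E x \<le> ennreal \<epsilon> * ennreal (u x)" if x: "x \<in> set_pmf \<mu>" for x
  proof (cases "x \<in> ?E")
    case True
    have "PEF_prod n F (fst x) (snd x) \<ge> 0"
      using len x by (intro PEF_prod_nonneg[OF assms(3)]) auto
    then have "1 \<le> \<epsilon> * u x"
      using True one_le_if_neg_root_le[OF \<open>\<beta> > 0\<close>, of "\<epsilon> * PEF_prod n F (fst x) (snd x)"
          "cprob \<mu> (fst x) (snd x)"] \<open>\<epsilon> > 0\<close>
      by (simp add: u_def mult.assoc)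
    then show ?thesis
      using True \<open>\<epsilon> > 0\<close> by (simp add: ennreal_mult'[symmetric])
  qed simp
  have "emeasure (measure_pmf \<mu>) ?E = (\<integral>\<^sup>+x. indicator ?E x \<partial>measure_pmf \<mu>)"
    by simp
  also have "\<dots> \<le> (\<integral>\<^sup>+x. ennreal \<epsilon> * ennreal (u x) \<partial>measure_pmf \<mu>)"
    by (rule nn_integral_mono_AE) (simp add: AE_measure_pmf_iff ind)
  also have "\<dots> = ennreal \<epsilon> * (\<integral>\<^sup>+x. ennreal (u x) \<partial>measure_pmf \<mu>)"
    by (rule nn_integral_cmult) simp
  also have "\<dots> \<le> ennreal \<epsilon> * 1"
    by (rule mult_left_mono[OF u_le]) simp
  finally have "measure_pmf.prob \<mu> ?E \<le> \<epsilon>"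
    using \<open>\<epsilon> > 0\<close> by (simp add: measure_pmf.emeasure_eq_measure)
  then show ?thesis
    by simp
qed

end
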